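(* Let $k \ge 2$ be an integer and let $G$ be a finite $k$-regular, $k$-connected bipartite graph. If $G$ contains $\lfloor k/2 \rfloor$ completely independent spanning trees, then \[ \left\lceil \frac{\frac{|V(G)|}{2} - 1}{\lceil k/2 \rceil} \right\rceil \le \left\lfloor \frac{\frac{|V(G)|}{2}}{\lfloor k/2 \rfloor} \right\rfloor . \]
   Context: For a tree $T$ and vertices $u,v$ of $T$, let $P_T(u,v)$ denote the set of vertices on the unique $u$–$v$ path in $T$. Spanning trees $T_1,\dots,T_m$ of a graph $G$ are called completely independent spanning trees (CISTs) if they are pairwise edge-disjoint and, for every pair of distinct trees $T_i,T_j$ and every pair of vertices $u,v\in V(G)$, $P_{T_i}(u,v)\cap P_{T_j}(u,v)=\{u,v\}$ (the $u$–$v$ paths in different trees share no vertices other than $u,v$ and no edges). A $k$-regular bipartite graph with $k>0$ has partite sets of equal size $|V(G)|/2$. *)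

theory Defs
  imports Complex_Main "Graph_Theory.Digraph_Component"
begin

text \<open>
  A finite simple graph is the locale predicate \<open>graph\<close> of Graph_Theory: a finite, symmetric,
  loop-free digraph without parallel arcs.  An undirected edge is thus a pair of opposite arcs.
\<close>

text \<open>By symmetry, in-degree and out-degree both equal the undirected degree.\<close>

definition regular :: "nat \<Rightarrow> ('a,'b) pre_digraph \<Rightarrow> bool" where
  "regular k G \<longleftrightarrow> (\<forall>v \<in> verts G. out_degree G v = k)"

definition bipartite :: "('a,'b) pre_digraph \<Rightarrow> bool" where
  "bipartite G \<longleftrightarrow> (\<exists>A B. A \<union> B = verts G \<and> A \<inter> B = {} \<and>
     (\<forall>e \<in> arcs G. (tail G e \<in> A \<and> head G e \<in> B) \<or> (tail G e \<in> B \<and> head G e \<in> A)))"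

definition vertex_connected :: "nat \<Rightarrow> ('a,'b) pre_digraph \<Rightarrow> bool" where
  "vertex_connected k G \<longleftrightarrow> k < card (verts G) \<and>
     (\<forall>S \<subseteq> verts G. card S < k \<longrightarrow> Digraph_Component.connected (G \<restriction> (verts G - S)))"

text \<open>
  The library's \<open>forest\<close> and \<open>tree\<close> forbid every directed cycle, including the closed walk
  that traverses an edge back and forth, so they exclude every symmetric digraph with an edge.
  The cycles of an undirected simple graph are the directed cycles of length at least 3.
\<close>

definition undirected_tree :: "('a,'b) pre_digraph \<Rightarrow> bool" where
  "undirected_tree T \<longleftrightarrow> graph T \<and> Digraph_Component.connected T \<and>
     \<not> (\<exists>p. pre_digraph.cycle T p \<and> 3 \<le> length p)"

text \<open>\<open>P\<^sub>T(u,v)\<close>; meaningful when \<open>T\<close> is a tree and \<open>u\<close>, \<open>v\<close> are vertices of \<open>T\<close>.\<close>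

definition tree_path_verts :: "('a,'b) pre_digraph \<Rightarrow> 'a \<Rightarrow> 'a \<Rightarrow> 'a set" where
  "tree_path_verts T u v =
     set (pre_digraph.awalk_verts T u (THE p. pre_digraph.apath T u p v))"

text \<open>
  Every tree contains each of its edges in both orientations, so disjointness of the
  arc sets is edge-disjointness.
\<close>

definition CISTs :: "('a,'b) pre_digraph \<Rightarrow> nat \<Rightarrow> (nat \<Rightarrow> ('a,'b) pre_digraph) \<Rightarrow> bool" where
  "CISTs G m T \<longleftrightarrow>
     (\<forall>i \<in> {1..m}. undirected_tree (T i) \<and> spanning (T i) G) \<and>
     (\<forall>i \<in> {1..m}. \<forall>j \<in> {1..m}. i \<noteq> j \<longrightarrow>
        arcs (T i) \<inter> arcs (T j) = {} \<and>
        (\<forall>u \<in> verts G. \<forall>v \<in> verts G.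
           tree_path_verts (T i) u v \<inter> tree_path_verts (T j) u v = {u, v}))"

end

theory Submission
  imports Defs
begin

text \<open>
  A vertex of degree at least 2 in two of the trees would separate, in both of them, a common
  pair of vertices: two equivalence relations covering all pairs cannot both be nontrivial.
  So each vertex is internal in at most one of the \<open>m = \<lfloor>k/2\<rfloor>\<close> trees.  Let \<open>A\<close> be the smaller
  partite set, let \<open>n\<close> be half the number of vertices, and let \<open>a\<close> count the internal vertices
  of a given tree in \<open>A\<close>.  Every edge of that tree has one end in \<open>A\<close>, and every vertex
  of \<open>A\<close> sends at least one edge into each of the other \<open>m - 1\<close> trees, so that
  \<open>2n - 1 \<le> (|A| - a) + a (k - m + 1)\<close>, whence \<open>n - 1 \<le> a (k - m)\<close>.  Summing
  \<open>\<lceil>(n - 1) / (k - m)\<rceil> \<le> a\<close> over the trees gives the claim.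
\<close>

section \<open>Components left after deleting a vertex\<close>

text \<open>In a symmetric digraph this is the relation of lying in the same component of the graph
  minus \<open>v\<close>. Using walks rather than paths makes transitivity plain
  concatenation.\<close>

definition (in pre_digraph) linked_avoiding :: "'a \<Rightarrow> 'a \<Rightarrow> 'a \<Rightarrow> bool" where
  "linked_avoiding v x y \<longleftrightarrow> (\<exists>p. awalk x p y \<and> v \<notin> set (awalk_verts x p))"

lemma (in wf_digraph) linked_avoiding_trans:
  assumes "linked_avoiding v x y" and "linked_avoiding v y z"
  shows "linked_avoiding v x z"
proof -
  from assms obtain p q where pq: "awalk x p y" "v \<notin> set (awalk_verts x p)"
    "awalk y q z" "v \<notin> set (awalk_verts y q)"
    unfolding linked_avoiding_def by blast
  then have "awalk x (p @ q) z" "v \<notin> set (awalk_verts x (p @ q))"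
    using set_awalk_verts_append[OF pq(1,3)] awalk_appendI by auto
  then show ?thesis unfolding linked_avoiding_def by blast
qed

lemma (in sym_digraph) reverse_arc:
  assumes "e \<in> arcs G"
  obtains g where "g \<in> arcs G" "tail G g = head G e" "head G g = tail G e"
  using assms sym_arcs unfolding symmetric_conv by metis

lemma (in sym_digraph) linked_avoiding_sym:
  assumes "linked_avoiding v x y"
  shows "linked_avoiding v y x"
proof -
  have "linked_avoiding v y x" if "awalk x p y" "v \<notin> set (awalk_verts x p)" for p
    using that
  proof (induction p arbitrary: x)
    case Nil
    then show ?case unfolding linked_avoiding_def by (auto simp: awalk_Nil_iff intro!: exI[of _ "[]"])
  next
    case (Cons e p)
    then have e: "e \<in> arcs G" "tail G e = x" "awalk (head G e) p y"
      "v \<noteq> x" "v \<notin> set (awalk_verts (head G e) p)"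
      by (auto simp: awalk_Cons_iff)
    then have "v \<noteq> head G e" using hd_in_awalk_verts(1) by blast
    obtain g where g: "g \<in> arcs G" "tail G g = head G e" "head G g = tail G e"
      using reverse_arc e(1) by blast
    then have "awalk (head G e) [g] x" "v \<notin> set (awalk_verts (head G e) [g])"
      using e \<open>v \<noteq> head G e\<close> by (auto simp: awalk_simps)
    then have "linked_avoiding v (head G e) x" unfolding linked_avoiding_def by blast
    with Cons.IH[OF e(3,5)] show ?case by (rule linked_avoiding_trans)
  qed
  with assms show ?thesis unfolding linked_avoiding_def by blast
qed

lemma (in wf_digraph) linked_avoiding_apath:
  assumes "linked_avoiding v x y"
  obtains p where "apath x p y" "v \<notin> set (awalk_verts x p)"
proof -
  from assms obtain p where p: "awalk x p y" "v \<notin> set (awalk_verts x p)"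
    unfolding linked_avoiding_def by blast
  have "apath x (awalk_to_apath p) y" using p(1) by (rule apath_awalk_to_apath)
  moreover have "set (awalk_verts x (awalk_to_apath p)) \<subseteq> set (awalk_verts x p)"
    using awalk_to_apath_subset[OF p(1)] set_awalk_verts[OF p(1)]
      set_awalk_verts[OF awalkI_apath[OF calculation]] by auto
  ultimately show thesis using p(2) that by blast
qed

section \<open>Paths and cut vertices in trees\<close>

text \<open>A path that joins two neighbours of \<open>v\<close> and misses \<open>v\<close> closes
  up through \<open>v\<close>: leave by \<open>e\<close>, follow the path, return by the reverse of
  \<open>f\<close>.\<close>

lemma (in graph) linked_neighbours_imp_cycle:
  assumes e: "e \<in> out_arcs G v" and f: "f \<in> out_arcs G v" and "e \<noteq> f"
    and "linked_avoiding v (head G e) (head G f)"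
  shows "\<exists>p. cycle p \<and> 3 \<le> length p"
proof -
  obtain r where r: "apath (head G e) r (head G f)" "v \<notin> set (awalk_verts (head G e) r)"
    using linked_avoiding_apath assms(4) by blast
  \<comment> \<open>Without parallel arcs, distinct arcs leaving \<open>v\<close> have distinct
    heads. So the connecting path is nonempty, and the closed walk is longer than a mere
    back-and-forth along one edge.\<close>
  have "head G e \<noteq> head G f"
    using no_multi_arcs[of e f] e f \<open>e \<noteq> f\<close> by (auto simp: arc_to_ends_def)
  then have "r \<noteq> []" using r(1) by (auto simp: apath_Nil_iff)
  obtain g where g: "g \<in> arcs G" "tail G g = head G f" "head G g = v"
    using reverse_arc f by auto
  have rw: "awalk (head G e) r (head G f)" using r(1) by (rule awalkI_apath)
  have gw: "awalk (head G f) [g] v" using g by (auto simp: awalk_simps)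
  have w: "awalk (head G e) (r @ [g]) v" using awalk_appendI[OF rw gw] .
  have "awalk_verts (head G e) (r @ [g]) = awalk_verts (head G e) r @ [v]"
    using awalk_verts_append[OF w] g by simp
  then have "distinct (tl (awalk_verts v (e # r @ [g])))"
    using r by (auto simp: apath_def)
  moreover have "awalk v (e # r @ [g]) v" using w e by (auto simp: awalk_Cons_iff)
  ultimately have "cycle (e # r @ [g])" unfolding cycle_def by blast
  moreover have "3 \<le> length (e # r @ [g])" using \<open>r \<noteq> []\<close> by (cases r) auto
  ultimately show ?thesis by blast
qed

text \<open>Compare first arcs: after leaving \<open>u\<close>, both paths reach \<open>v\<close>
  without meeting \<open>u\<close> again, so the heads of their first arcs are linked avoiding
  \<open>u\<close>. Distinct first arcs would therefore give a cycle.\<close>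

lemma (in graph) unique_apath:
  assumes acyclic: "\<not> (\<exists>p. cycle p \<and> 3 \<le> length p)"
    and "apath u p v" and "apath u q v"
  shows "p = q"
  using assms(2,3)
proof (induction p arbitrary: u q)
  case Nil
  then show ?case using apath_nonempty_ends by (auto simp: apath_Nil_iff)
next
  case (Cons e p)
  then have "q \<noteq> []" using apath_nonempty_ends by (force simp: apath_Nil_iff)
  then obtain f q' where q: "q = f # q'" by (cases q) auto
  have e: "e \<in> out_arcs G u" "apath (head G e) p v" "u \<notin> set (awalk_verts (head G e) p)"
    using Cons.prems(1) by (auto simp: apath_Cons_iff)
  have f: "f \<in> out_arcs G u" "apath (head G f) q' v" "u \<notin> set (awalk_verts (head G f) q')"
    using Cons.prems(2) q by (auto simp: apath_Cons_iff)
  have "linked_avoiding u (head G e) v" "linked_avoiding u (head G f) v"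
    using e f awalkI_apath unfolding linked_avoiding_def by blast+
  then have "linked_avoiding u (head G e) (head G f)"
    using linked_avoiding_trans linked_avoiding_sym by blast
  then have "e = f" using linked_neighbours_imp_cycle e(1) f(1) acyclic by blast
  with Cons.IH[OF e(2)] f(2) q show ?case by simp
qed

lemma (in graph) connected_reachable:
  assumes "connected G" "u \<in> verts G" "v \<in> verts G"
  shows "u \<rightarrow>\<^sup>* v"
  using symmetric_connected_imp_strongly_connected[OF sym_arcs assms(1)] assms(2,3)
  unfolding strongly_connected_def by blast

text \<open>Turns the path condition on CISTs into a statement about equivalence relations.
  Connectedness and uniqueness of paths give the \<open>THE\<close> in
  \<open>tree_path_verts\<close> its intended value.\<close>

lemma tree_path_verts_linked_avoiding:
  assumes T: "undirected_tree T" and uv: "u \<in> verts T" "v \<in> verts T"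
  shows "x \<notin> tree_path_verts T u v \<longleftrightarrow> pre_digraph.linked_avoiding T x u v"
proof -
  interpret graph T using T unfolding undirected_tree_def by blast
  have acyclic: "\<not> (\<exists>p. cycle p \<and> 3 \<le> length p)" and con: "connected T"
    using T unfolding undirected_tree_def by blast+
  obtain p where p: "apath u p v"
    using connected_reachable[OF con uv] reachable_apath by blast
  have uniq: "q = p" if "apath u q v" for q using unique_apath[OF acyclic that p] .
  have "(THE p. apath u p v) = p" using p uniq by (rule the_equality)
  then have "tree_path_verts T u v = set (awalk_verts u p)"
    unfolding tree_path_verts_def by simp
  moreover have "linked_avoiding x u v \<longleftrightarrow> x \<notin> set (awalk_verts u p)"
    using linked_avoiding_apath[of x u v] uniq p awalkI_apath
    unfolding linked_avoiding_def by metis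
  ultimately show ?thesis by simp
qed

text \<open>Two neighbours of \<open>v\<close> serve as \<open>x\<close> and \<open>y\<close>: a
  link between them avoiding \<open>v\<close> would close a cycle.\<close>

lemma tree_internal_vertex:
  assumes T: "undirected_tree T" and "2 \<le> out_degree T v"
  obtains x y where "x \<in> verts T" "y \<in> verts T" "x \<noteq> v" "y \<noteq> v"
    "\<not> pre_digraph.linked_avoiding T v x y"
proof -
  interpret graph T using T unfolding undirected_tree_def by blast
  have "finite (out_arcs T v)" by blast
  then obtain e f where "e \<in> out_arcs T v" "f \<in> out_arcs T v" "e \<noteq> f"
    using assms(2) unfolding out_degree_def
    by (metis card_le_Suc0_iff_eq not_less_eq_eq numeral_2_eq_2)
  then show thesis
    using that[of "head T e" "head T f"] linked_neighbours_imp_cycle no_loops T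
    unfolding undirected_tree_def by fastforce
qed

section \<open>Internal vertices of different trees\<close>

lemma CISTs_tree:
  assumes "CISTs G m T" "i \<in> {1..m}"
  shows "undirected_tree (T i)" "verts (T i) = verts G" "subgraph (T i) G"
  using assms unfolding CISTs_def spanning_def by blast+

lemma internal_vertices_disjoint:
  assumes T: "CISTs G m T" and ij: "i \<in> {1..m}" "j \<in> {1..m}" "i \<noteq> j"
    and di: "2 \<le> out_degree (T i) v"
  shows "\<not> 2 \<le> out_degree (T j) v"
proof
  assume dj: "2 \<le> out_degree (T j) v"
  note ti = CISTs_tree[OF T ij(1)] and tj = CISTs_tree[OF T ij(2)]
  interpret i: graph "T i" using ti unfolding undirected_tree_def by blast
  interpret j: graph "T j" using tj unfolding undirected_tree_def by blast
  \<comment> \<open>A vertex \<open>v\<close> other than \<open>x\<close> and \<open>y\<close>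
    cannot lie on both tree paths, so at least one of the two relations holds for each such
    pair.\<close>
  have cover: "i.linked_avoiding v x y \<or> j.linked_avoiding v x y"
    if "x \<in> verts G" "y \<in> verts G" "x \<noteq> v" "y \<noteq> v" for x y
  proof -
    have "tree_path_verts (T i) x y \<inter> tree_path_verts (T j) x y = {x, y}"
      using T ij that unfolding CISTs_def by blast
    then have "v \<notin> tree_path_verts (T i) x y \<or> v \<notin> tree_path_verts (T j) x y"
      using that(3,4) by (metis IntI insertE singletonD)
    then show ?thesis
      using tree_path_verts_linked_avoiding ti tj that by metis
  qed
  obtain x x' where x: "x \<in> verts G" "x' \<in> verts G" "x \<noteq> v" "x' \<noteq> v"
    "\<not> i.linked_avoiding v x x'"
    using tree_internal_vertex[OF ti(1) di] ti(2) by metis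
  obtain y y' where y: "y \<in> verts G" "y' \<in> verts G" "y \<noteq> v" "y' \<noteq> v"
    "\<not> j.linked_avoiding v y y'"
    using tree_internal_vertex[OF tj(1) dj] tj(2) by metis
  note R = i.linked_avoiding_trans i.linked_avoiding_sym
    j.linked_avoiding_trans j.linked_avoiding_sym
  have jx: "j.linked_avoiding v x x'" and iy: "i.linked_avoiding v y y'"
    using cover x y by blast+
  show False
  \<comment> \<open>In tree \<open>i\<close>, \<open>y\<close> and \<open>y'\<close> share a class,
    while \<open>x\<close> and \<open>x'\<close> do not. So one of \<open>x\<close>,
    \<open>x'\<close> lies outside the class of \<open>y\<close>; by \<open>cover\<close> it is
    linked to both \<open>y\<close> and \<open>y'\<close> in tree \<open>j\<close>, which links
    \<open>y\<close> to \<open>y'\<close> there.\<close>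
  proof (cases "i.linked_avoiding v y x")
    case True
    then have "\<not> i.linked_avoiding v y x'" "\<not> i.linked_avoiding v y' x'"
      using R(1,2) x(5) iy by blast+
    then have "j.linked_avoiding v y x'" "j.linked_avoiding v y' x'" using cover x y by blast+
    then show False using R(3,4) y(5) by blast
  next
    case False
    then have "\<not> i.linked_avoiding v y' x" using R(1,2) iy by blast
    with False have "j.linked_avoiding v y x" "j.linked_avoiding v y' x"
      using cover x y by blast+
    then show False using R(3,4) y(5) by blast
  qed
qed

section \<open>Edge and degree counts in connected graphs\<close>

lemma (in graph) connected_boundary_arc:
  assumes con: "connected G" and S: "S \<subseteq> verts G" "S \<noteq> {}" "S \<noteq> verts G"
  obtains e where "e \<in> arcs G" "tail G e \<in> S" "head G e \<notin> S"
proof -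
  from S obtain u v where uv: "u \<in> S" "v \<in> verts G" "v \<notin> S" by blast
  have "u \<rightarrow>\<^sup>* v" using connected_reachable con uv S(1) by blast
  then have "\<exists>e. e \<in> arcs G \<and> tail G e \<in> S \<and> head G e \<notin> S"
    using uv(1,3)
  proof (induction rule: converse_reachable_induct)
    case base
    then show ?case by blast
  next
    case (step x y)
    then show ?case by (metis reachableE)
  qed
  then show thesis using that by blast
qed

text \<open>A connected graph has at least one edge fewer than vertices, and every edge has an
  orientation with tail in \<open>A\<close>. The proof grows a vertex set along boundary arcs, each
  new vertex bringing a new counted arc.\<close>

lemma (in graph) connected_bipartite_card_verts:
  assumes con: "connected G"
    and cross: "\<And>e. e \<in> arcs G \<Longrightarrow>
      (tail G e \<in> A \<and> head G e \<in> B) \<or> (tail G e \<in> B \<and> head G e \<in> A)"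
  shows "card (verts G) \<le> Suc (card {e \<in> arcs G. tail G e \<in> A})"
proof -
  define E where "E S = {e \<in> arcs G. tail G e \<in> A \<and> tail G e \<in> S \<and> head G e \<in> S}" for S
  have finE: "finite (E S)" for S unfolding E_def by simp
  have "\<exists>S \<subseteq> verts G. card S = j \<and> j \<le> Suc (card (E S))" if "j \<le> card (verts G)" for j
    using that
  proof (induction j)
    case 0
    then show ?case by (intro exI[of _ "{}"]) auto
  next
    case (Suc j)
    then obtain S where S: "S \<subseteq> verts G" "card S = j" "j \<le> Suc (card (E S))" by auto
    have finS: "finite S" using S(1) finite_subset finite_verts by blast
    show ?case
    proof (cases "S = {}")
      case True
      from Suc.prems obtain v where "v \<in> verts G" by (metis card.empty all_not_in_conv not_less_eq_eq le0)
      then show ?thesis using True S(2) by (intro exI[of _ "{v}"]) auto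
    next
      case False
      have "S \<noteq> verts G" using Suc.prems S(2) by auto
      then obtain e where e: "e \<in> arcs G" "tail G e \<in> S" "head G e \<notin> S"
        using connected_boundary_arc con S(1) False by blast
      let ?S = "insert (head G e) S"
      obtain g where g: "g \<in> arcs G" "tail G g = head G e" "head G g = tail G e"
        using reverse_arc e(1) by blast
      \<comment> \<open>The new arc is \<open>e\<close> or its reverse \<open>g\<close>, whichever
        has its tail in \<open>A\<close>; it has an end outside \<open>S\<close>.\<close>
      have "\<exists>f. f \<in> E ?S \<and> f \<notin> E S"
        using cross[OF e(1)] e g unfolding E_def by force
      then have "E S \<subset> E ?S" unfolding E_def by auto
      then have "card (E S) < card (E ?S)" using finE psubset_card_mono by blast
      moreover have "card ?S = Suc j" using S(2) e finS by simp
      moreover have "?S \<subseteq> verts G" using S(1) e(1) by auto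
      ultimately show ?thesis using S(3) by (intro exI[of _ ?S]) auto
    qed
  qed
  then obtain S where "card (verts G) \<le> Suc (card (E S))" by blast
  also have "card (E S) \<le> card {e \<in> arcs G. tail G e \<in> A}"
    unfolding E_def by (intro card_mono) auto
  finally show ?thesis by simp
qed

lemma (in graph) connected_out_degree_pos:
  assumes "connected G" "v \<in> verts G" "2 \<le> card (verts G)"
  shows "1 \<le> out_degree G v"
proof -
  have "{v} \<noteq> verts G"
  proof
    assume "{v} = verts G"
    then have "card (verts G) = 1" by (metis is_singletonI is_singleton_altdef)
    then show False using assms(3) by simp
  qed
  then obtain e where "e \<in> out_arcs G v"
    using connected_boundary_arc[of "{v}"] assms(1,2) by auto
  then show ?thesis
    unfolding out_degree_def by (metis One_nat_def Suc_leI card_gt_0_iff empty_iff finite_out_arcs)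
qed

lemma (in fin_digraph) card_arcs_tail:
  assumes "finite A"
  shows "card {e \<in> arcs G. tail G e \<in> A} = (\<Sum>v\<in>A. out_degree G v)"
proof -
  have "{e \<in> arcs G. tail G e \<in> A} = (\<Union>v\<in>A. out_arcs G v)" by auto
  also have "card \<dots> = (\<Sum>v\<in>A. card (out_arcs G v))"
    by (intro card_UN_disjoint assms) auto
  finally show ?thesis unfolding out_degree_def .
qed

section \<open>Degree counts across the trees\<close>

lemma CISTs_sum_out_degree:
  assumes "graph G" and T: "CISTs G m T"
  shows "(\<Sum>i\<in>{1..m}. out_degree (T i) v) \<le> out_degree G v"
proof -
  interpret graph G by fact
  have sub: "out_arcs (T i) v \<subseteq> out_arcs G v" if "i \<in> {1..m}" for i
    using CISTs_tree(3)[OF T that] unfolding subgraph_def compatible_def by auto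
  have "(\<Sum>i\<in>{1..m}. out_degree (T i) v) = card (\<Union>i\<in>{1..m}. out_arcs (T i) v)"
    unfolding out_degree_def
  proof (rule card_UN_disjoint[symmetric])
    show "\<forall>i\<in>{1..m}. finite (out_arcs (T i) v)" using sub finite_out_arcs finite_subset by blast
    show "\<forall>i\<in>{1..m}. \<forall>j\<in>{1..m}. i \<noteq> j \<longrightarrow> out_arcs (T i) v \<inter> out_arcs (T j) v = {}"
      using T unfolding CISTs_def out_arcs_def by blast
  qed simp
  also have "\<dots> \<le> card (out_arcs G v)"
    using sub by (intro card_mono finite_out_arcs UN_least)
  finally show ?thesis unfolding out_degree_def .
qed

text \<open>Each of the other \<open>m - 1\<close> trees spans the graph and so takes at least one
  arc at \<open>v\<close>, all of these arcs being distinct; tree \<open>i\<close> has only the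
  rest.\<close>

lemma CISTs_out_degree_le:
  assumes G: "graph G" "2 \<le> card (verts G)" and T: "CISTs G m T"
    and i: "i \<in> {1..m}" and v: "v \<in> verts G"
  shows "out_degree (T i) v + m \<le> Suc (out_degree G v)"
proof -
  have pos: "1 \<le> out_degree (T j) v" if "j \<in> {1..m}" for j
  proof -
    have "graph (T j)" "connected (T j)" "verts (T j) = verts G"
      using CISTs_tree[OF T that] unfolding undirected_tree_def by auto
    then show ?thesis using graph.connected_out_degree_pos v G(2) by metis
  qed
  have "m - 1 = (\<Sum>j\<in>{1..m} - {i}. 1)" using i by simp
  also have "\<dots> \<le> (\<Sum>j\<in>{1..m} - {i}. out_degree (T j) v)" using pos by (intro sum_mono) auto
  finally have "m - 1 + out_degree (T i) v \<le> (\<Sum>j\<in>{1..m}. out_degree (T j) v)"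
    using i by (simp add: sum.remove[of _ i])
  then show ?thesis using CISTs_sum_out_degree[OF G(1) T, of v] i by auto
qed

text \<open>The tree has at least |A| + |B| - 1 edges, which are counted by degrees in
  \<open>A\<close>. One unit of degree per vertex of \<open>A\<close> cancels |A|; the excess, at
  most \<open>k - m\<close>, occurs only at internal vertices.\<close>

lemma CISTs_card_internal_lower:
  assumes G: "graph G" "2 \<le> card (verts G)" "\<And>v. v \<in> verts G \<Longrightarrow> out_degree G v \<le> k"
    and T: "CISTs G m T" and i: "i \<in> {1..m}"
    and AB: "A \<union> B = verts G" "A \<inter> B = {}"
    and cross: "\<And>e. e \<in> arcs G \<Longrightarrow>
      (tail G e \<in> A \<and> head G e \<in> B) \<or> (tail G e \<in> B \<and> head G e \<in> A)"
  shows "card B \<le> Suc (card {v \<in> A. 2 \<le> out_degree (T i) v} * (k - m))"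
proof -
  interpret graph G by fact
  have t: "graph (T i)" "connected (T i)" "verts (T i) = verts G" "subgraph (T i) G"
    using CISTs_tree[OF T i] unfolding undirected_tree_def by auto
  interpret t: graph "T i" by fact
  have fin: "finite A" "finite B" using AB(1) finite_verts by (metis finite_Un)+
  define I where "I = {v \<in> A. 2 \<le> out_degree (T i) v}"
  have I: "I \<subseteq> A" "finite I" using fin unfolding I_def by auto
  have "(tail (T i) e \<in> A \<and> head (T i) e \<in> B) \<or> (tail (T i) e \<in> B \<and> head (T i) e \<in> A)"
    if "e \<in> arcs (T i)" for e
    using cross[of e] that t(4) unfolding subgraph_def compatible_def by auto
  then have "card (verts G) \<le> Suc (card {e \<in> arcs (T i). tail (T i) e \<in> A})"
    using t.connected_bipartite_card_verts[OF t(2)] t(3) by metis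
  then have "card A + card B \<le> Suc (\<Sum>v\<in>A. out_degree (T i) v)"
    using card_Un_disjoint[OF fin AB(2)] AB(1) t.card_arcs_tail[OF fin(1)] by simp
  also have "(\<Sum>v\<in>A. out_degree (T i) v)
      = (\<Sum>v\<in>A - I. out_degree (T i) v) + (\<Sum>v\<in>I. out_degree (T i) v)"
    using I fin by (intro sum.subset_diff)
  also have "(\<Sum>v\<in>A - I. out_degree (T i) v) \<le> (\<Sum>v\<in>A - I. 1)"
    unfolding I_def by (intro sum_mono) auto
  also have "(\<Sum>v\<in>I. out_degree (T i) v) \<le> (\<Sum>v\<in>I. Suc (k - m))"
  proof (rule sum_mono)
    fix v assume "v \<in> I"
    then have "v \<in> verts G" using I AB by blast
    then have "out_degree (T i) v + m \<le> Suc k"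
      using CISTs_out_degree_le[OF G(1,2) T i] G(3) by (meson Suc_le_mono le_trans)
    then show "out_degree (T i) v \<le> Suc (k - m)" by simp
  qed
  \<comment> \<open>The bound \<open>Suc (k - m)\<close> is split into 1 and \<open>k - m\<close>,
    so that the ones over \<open>I\<close> and over \<open>A - I\<close> add up to |A|.\<close>
  finally have "card A + card B \<le> Suc (card (A - I) + card I + card I * (k - m))" by simp
  moreover have "card (A - I) + card I = card A"
    using I fin by (metis card_Diff_subset card_mono le_add_diff_inverse2)
  ultimately show ?thesis unfolding I_def by simp
qed

lemma CISTs_sum_card_internal:
  assumes T: "CISTs G m T" and "finite A"
  shows "(\<Sum>i\<in>{1..m}. card {v \<in> A. 2 \<le> out_degree (T i) v}) \<le> card A"
proof -
  have "(\<Sum>i\<in>{1..m}. card {v \<in> A. 2 \<le> out_degree (T i) v})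
      = card (\<Union>i\<in>{1..m}. {v \<in> A. 2 \<le> out_degree (T i) v})"
  proof (rule card_UN_disjoint[symmetric])
    show "\<forall>i\<in>{1..m}. finite {v \<in> A. 2 \<le> out_degree (T i) v}" using assms(2) by simp
    show "\<forall>i\<in>{1..m}. \<forall>j\<in>{1..m}. i \<noteq> j \<longrightarrow>
        {v \<in> A. 2 \<le> out_degree (T i) v} \<inter> {v \<in> A. 2 \<le> out_degree (T j) v} = {}"
      using internal_vertices_disjoint[OF T] by blast
  qed simp
  also have "\<dots> \<le> card A" using assms(2) by (intro card_mono) auto
  finally show ?thesis .
qed

section \<open>Combining the bounds and rounding\<close>

theorem theorem3p1:
  fixes G :: "('a,'b) pre_digraph" and k :: nat
  assumes "2 \<le> k"
    and "graph G"
    and "regular k G"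
    and "vertex_connected k G"
    and "bipartite G"
    and "\<exists>T. CISTs G (nat \<lfloor>real k / 2\<rfloor>) T"
  shows "\<lceil>(real (card (verts G)) / 2 - 1) / real_of_int \<lceil>real k / 2\<rceil>\<rceil>
       \<le> \<lfloor>(real (card (verts G)) / 2) / real_of_int \<lfloor>real k / 2\<rfloor>\<rfloor>"
proof -
  interpret graph G by fact
  define m where "m = k div 2"
  define N where "N = card (verts G)"
  have fl: "\<lfloor>real k / 2\<rfloor> = int m" unfolding m_def by linarith
  have ce: "\<lceil>real k / 2\<rceil> = int (k - m)" unfolding m_def by linarith
  have m: "0 < m" "0 < k - m" using assms(1) unfolding m_def by auto
  obtain T where T: "CISTs G m T" using assms(6) fl by auto
  have N: "2 \<le> card (verts G)" using assms(1,4) unfolding vertex_connected_def by auto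
  have deg: "out_degree G v \<le> k" if "v \<in> verts G" for v
    using assms(3) that unfolding regular_def by auto
  \<comment> \<open>Calling the smaller side \<open>A\<close> gives |A| <= N/2 <= |B|. The bound for
    a single tree involves |B|, and the bound on the sum over all trees involves |A|.\<close>
  obtain A B where AB: "A \<union> B = verts G" "A \<inter> B = {}" "card A \<le> card B"
    and cross: "\<And>e. e \<in> arcs G \<Longrightarrow>
      (tail G e \<in> A \<and> head G e \<in> B) \<or> (tail G e \<in> B \<and> head G e \<in> A)"
    using assms(5) unfolding bipartite_def by (metis Int_commute Un_commute nat_le_linear)
  have fin: "finite A" "finite B" using AB(1) finite_verts by (metis finite_Un)+
  have "N = card A + card B" unfolding N_def using card_Un_disjoint[OF fin AB(2)] AB(1) by simp
  then have half: "real (card A) \<le> real N / 2" "real N / 2 \<le> real (card B)" using AB(3) by auto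
  define q where "q = \<lceil>(real N / 2 - 1) / real (k - m)\<rceil>"
  have "q \<le> int (card {v \<in> A. 2 \<le> out_degree (T i) v})" if i: "i \<in> {1..m}" for i
  proof -
    let ?a = "card {v \<in> A. 2 \<le> out_degree (T i) v}"
    have "card B \<le> Suc (?a * (k - m))"
      by (rule CISTs_card_internal_lower[OF assms(2) N deg T i AB(1,2) cross])
    then have "real (card B) \<le> real (Suc (?a * (k - m)))" by (rule of_nat_mono)
    then have "real N / 2 - 1 \<le> real ?a * real (k - m)" using half(2) by simp
    then have "(real N / 2 - 1) / real (k - m) \<le> real ?a" using m(2) by (simp add: divide_le_eq)
    \<comment> \<open>The number of internal vertices is an integer, so the ceiling can be taken
      tree by tree, before summing.\<close>
    then show ?thesis unfolding q_def by (simp add: ceiling_le_iff)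
  qed
  then have "(\<Sum>i\<in>{1..m}. q) \<le> (\<Sum>i\<in>{1..m}. int (card {v \<in> A. 2 \<le> out_degree (T i) v}))"
    by (intro sum_mono)
  also have "\<dots> \<le> int (card A)"
    using CISTs_sum_card_internal[OF T fin(1)] by (metis of_nat_mono of_nat_sum)
  finally have "int m * q \<le> int (card A)" by simp
  then have "real_of_int (int m * q) \<le> real_of_int (int (card A))" by (rule of_int_le_iff[THEN iffD2])
  then have "real m * real_of_int q \<le> real N / 2" using half(1) by simp
  then have "real_of_int q \<le> real N / 2 / real m" using m(1) by (simp add: le_divide_eq mult.commute)
  then have "q \<le> \<lfloor>real N / 2 / real m\<rfloor>" by (simp add: le_floor_iff)
  then show ?thesis unfolding fl ce q_def N_def by simp
qed

end
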